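(* For natural numbers $a,b,c,d,m,n,S$ such that $n \geq a \geq b$, $m \geq c \geq d$, and $\max(mb, nd)\leq S\leq \min(ma, nc)$, the following conditions are equivalent. (a) All pairs $(\underline{e},\underline{f}) \in P(a,b,c,d,m,n,S)$ are bipartite graphic. (b) $a=b$ or $c=d$ or, when $a>b$ and $c>d$, $$ar+cs \leq S + rs + \min\{\,r-p-d,\; s-q-b,\; r+s-p-q-b-d+1,\; 0\,\},$$ where $r=\left\lfloor\frac{S-mb}{a-b}\right\rfloor$, $s=\left\lfloor\frac{S-nd}{c-d}\right\rfloor$, $p=S-cs-d(n-s)$ and $q=S-ar-b(m-r)$.
   Context: For natural numbers $a,b,c,d,m,n,S$, $P(a,b,c,d,m,n,S)$ denotes the set of pairs $(\underline{e},\underline{f})$ of integer sequences of length $m,n$ respectively, each having sum $S$, with $\max(\underline{e})=a$, $\min(\underline{e})=b$, $\max(\underline{f})=c$, $\min(\underline{f})=d$ (maximum and minimum entries of the sequences). A pair $(\underline{e},\underline{f})$ of integer sequences is bipartite graphic if there exists a (simple) bipartite graph whose degree sequences are $\underline{e}$ and $\underline{f}$, that is, $\underline{e}$ lists the degrees of the vertices in one part and $\underline{f}$ lists the degrees of the vertices in the other part.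
   Formalization: The formal theorem additionally assumes that P(a,b,c,d,m,n,S) is nonempty; without this the equivalence fails, e.g. for (a,b,c,d,m,n,S) = (2,1,2,1,2,4,4), where P is empty, so (a) holds vacuously, but (b) is false. *)

theory Defs
  imports Complex_Main
begin

definition bipartite_graph :: "'v set \<Rightarrow> 'v set \<Rightarrow> 'v set set \<Rightarrow> bool" where
  "bipartite_graph X Y E \<longleftrightarrow>
     finite X \<and> finite Y \<and> X \<inter> Y = {} \<and> (\<forall>\<epsilon>\<in>E. \<exists>x\<in>X. \<exists>y\<in>Y. \<epsilon> = {x, y})"

definition degree :: "'v set set \<Rightarrow> 'v \<Rightarrow> nat" where
  "degree E v = card {\<epsilon> \<in> E. v \<in> \<epsilon>}"

text \<open>The lists \<open>xs\<close> and \<open>ys\<close> enumerate the two parts. The graphs are finite,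
  so taking the natural numbers as vertex type is no restriction.\<close>

definition bipartite_graphic :: "int list \<Rightarrow> int list \<Rightarrow> bool" where
  "bipartite_graphic e f \<longleftrightarrow>
     (\<exists>(xs :: nat list) ys E.
        distinct xs \<and> distinct ys \<and> bipartite_graph (set xs) (set ys) E \<and>
        e = map (\<lambda>v. int (degree E v)) xs \<and>
        f = map (\<lambda>v. int (degree E v)) ys)"

text \<open>Nonemptiness is required because \<open>Max\<close> and \<open>Min\<close> are unspecified on the empty set:
  the empty sequence has no maximum and no minimum.\<close>

definition seq_pairs ::
  "nat \<Rightarrow> nat \<Rightarrow> nat \<Rightarrow> nat \<Rightarrow> nat \<Rightarrow> nat \<Rightarrow> nat \<Rightarrow> (int list \<times> int list) set" where
  "seq_pairs a b c d m n S =
     {(e, f). length e = m \<and> length f = n \<and> sum_list e = int S \<and> sum_list f = int S \<and>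
        e \<noteq> [] \<and> Max (set e) = int a \<and> Min (set e) = int b \<and>
        f \<noteq> [] \<and> Max (set f) = int c \<and> Min (set f) = int d}"

end

theory Submission
  imports Defs
begin

text \<open>By the Gale--Ryser theorem a pair is graphic iff any \<open>k\<close> entries of \<open>e\<close> and any \<open>l\<close> entries
  of \<open>f\<close> together sum to at most \<open>S + k l\<close>. The sum of \<open>k\<close> entries of \<open>e\<close> is at most
  \<open>min (a k) (S - b (m - k))\<close>, a concave function of \<open>k\<close> that is linear except between \<open>r\<close> and
  \<open>r + 1\<close>, and one sequence attains this bound for every \<open>k\<close>; likewise for \<open>f\<close>. So all pairs are
  graphic iff the extremal one is. On each of the four rectangles cut out by \<open>r, r + 1\<close> and
  \<open>s, s + 1\<close> the inequality is bilinear, hence it suffices to check the corners. The outer corners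
  hold automatically, and the four inner ones are the four entries of the minimum in the theorem.\<close>

section \<open>Realizing prescribed degrees inside a given bipartite edge set\<close>

lemma card_Times_uncross:
  assumes "finite G"
  shows "card (G \<inter> (A \<inter> C) \<times> (B \<union> D)) + card (G \<inter> (A \<union> C) \<times> (B \<inter> D))
    \<le> card (G \<inter> A \<times> B) + card (G \<inter> C \<times> D)"
proof -
  let ?P = "G \<inter> (A \<inter> C) \<times> (B \<union> D)" and ?Q = "G \<inter> (A \<union> C) \<times> (B \<inter> D)"
  let ?U = "G \<inter> A \<times> B" and ?V = "G \<inter> C \<times> D"
  have "card ?P + card ?Q = card (?P \<union> ?Q) + card (?P \<inter> ?Q)"
    using assms by (intro card_Un_Int) auto
  \<comment> \<open>\<open>?P\<close> and \<open>?Q\<close> both lie in the union of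
    \<open>?U\<close> and \<open>?V\<close>, and their intersection is exactly that of
    \<open>?U\<close> and \<open>?V\<close>.\<close>
  also have "\<dots> \<le> card (?U \<union> ?V) + card (?U \<inter> ?V)"
    using assms by (intro add_mono card_mono) auto
  also have "\<dots> = card ?U + card ?V"
    using assms by (intro card_Un_Int[symmetric]) auto
  finally show ?thesis .
qed

lemma sum_Un_Int_swap:
  fixes e :: "'a \<Rightarrow> int"
  assumes "finite A" "finite C"
  shows "sum e (A \<inter> C) + sum e (A \<union> C) = sum e A + sum e C"
  using sum.union_inter[OF assms, of e] by simp

lemma sum_decrement:
  fixes e :: "'a \<Rightarrow> int"
  assumes "finite A"
  shows "(\<Sum>z\<in>A. e z - of_bool (z = x)) = sum e A - of_bool (x \<in> A)"
  using assms by (simp add: sum_subtractf of_bool_def)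

text \<open>An edge of \<open>G\<close> is either deleted or put into \<open>H\<close>. If both choices violate the cut condition,
  then uncrossing the two violating cuts violates it for \<open>G\<close> itself.\<close>

lemma prescribed_degrees_subgraph:
  fixes e :: "'a \<Rightarrow> int" and f :: "'b \<Rightarrow> int"
  assumes "finite G" "finite X" "finite Y" "G \<subseteq> X \<times> Y" "sum e X = S" "sum f Y = S"
    and "\<And>A B. A \<subseteq> X \<Longrightarrow> B \<subseteq> Y \<Longrightarrow> sum e A + sum f B \<le> S + int (card (G \<inter> A \<times> B))"
  shows "\<exists>H \<subseteq> G. (\<forall>x\<in>X. e x = int (card (H `` {x}))) \<and> (\<forall>y\<in>Y. f y = int (card (H\<inverse> `` {y})))"
  using assms
proof (induction G arbitrary: e f S rule: finite_induct)
  case empty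
  \<comment> \<open>Without edges, the cut omitting a single vertex forces its degree to be
    nonnegative, and the cut \<open>X\<close>, \<open>Y\<close> gives 2S \<le> S. Hence all degrees
    vanish.\<close>
  have e0: "e x \<ge> 0" if "x \<in> X" for x
    using empty.prems(6)[of "X - {x}" "{}"] empty.prems that by (simp add: sum_diff1)
  have f0: "f y \<ge> 0" if "y \<in> Y" for y
    using empty.prems(6)[of "{}" "Y - {y}"] empty.prems that by (simp add: sum_diff1)
  have "S \<le> 0"
    using empty.prems(6)[of X Y] empty.prems by simp
  moreover have "S \<ge> 0"
    using empty.prems(4) e0 by (metis sum_nonneg)
  ultimately have "sum e X = 0" "sum f Y = 0"
    using empty.prems by auto
  then have "\<forall>x\<in>X. e x = 0" "\<forall>y\<in>Y. f y = 0"
    using e0 f0 empty.prems by (auto simp: sum_nonneg_eq_0_iff)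
  then show ?case by auto
next
  case (insert z G)
  obtain x y where z: "z = (x, y)" by (cases z)
  have xy: "x \<in> X" "y \<in> Y" "G \<subseteq> X \<times> Y"
    using insert.prems z by auto
  have fin: "finite A" "finite B" if "A \<subseteq> X" "B \<subseteq> Y" for A B
    using that insert.prems by (auto intro: finite_subset)
  have card_ins: "card (insert z G \<inter> A \<times> B) = card (G \<inter> A \<times> B) + of_bool (x \<in> A \<and> y \<in> B)" for A B
    using insert.hyps by (auto simp: z Int_insert_left)
  show ?case
  proof (cases "\<forall>A B. A \<subseteq> X \<longrightarrow> B \<subseteq> Y \<longrightarrow> sum e A + sum f B \<le> S + int (card (G \<inter> A \<times> B))")
    case True
    then have "\<exists>H \<subseteq> G. (\<forall>x\<in>X. e x = int (card (H `` {x}))) \<and> (\<forall>y\<in>Y. f y = int (card (H\<inverse> `` {y})))"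
      using insert.prems xy by (intro insert.IH) auto
    then show ?thesis by blast
  next
    case False
    then obtain A B where AB: "A \<subseteq> X" "B \<subseteq> Y" "sum e A + sum f B > S + int (card (G \<inter> A \<times> B))"
      by (auto simp: not_le)
    \<comment> \<open>The cut is violated for \<open>G\<close> but not for
      \<open>insert z G\<close>, so it must count the edge \<open>z\<close>.\<close>
    have xyAB: "x \<in> A" "y \<in> B"
      using insert.prems(6)[of A B] AB card_ins[of A B] by (auto simp: of_bool_def split: if_splits)
    \<comment> \<open>These are the degrees still to be realized in \<open>G\<close> once
      \<open>z\<close> has been put into \<open>H\<close>.\<close>
    define e' where "e' = (\<lambda>u. e u - of_bool (u = x))"
    define f' where "f' = (\<lambda>v. f v - of_bool (v = y))"
    have e': "sum e' C = sum e C - of_bool (x \<in> C)" if "finite C" for C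
      unfolding e'_def using that by (rule sum_decrement)
    have f': "sum f' D = sum f D - of_bool (y \<in> D)" if "finite D" for D
      unfolding f'_def using that by (rule sum_decrement)
    have cut: "sum e' C + sum f' D \<le> (S - 1) + int (card (G \<inter> C \<times> D))"
      if CD: "C \<subseteq> X" "D \<subseteq> Y" for C D
    \<comment> \<open>If one endpoint of \<open>z\<close> lies in the cut, both sides drop by 1. If
      both do, the left side drops by 2, and the right side loses 1 from S and 1 from the missing
      edge \<open>z\<close>.\<close>
    proof (cases "x \<in> C \<or> y \<in> D")
      case True
      then show ?thesis
        using insert.prems(6)[of C D] CD fin[OF CD] card_ins[of C D]
        by (auto simp: e' f' of_bool_def split: if_splits)
    next
      case False
      \<comment> \<open>As x is not in C and y is not in D, neither uncrossed rectangle contains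
        \<open>z\<close>, so the hypothesis for \<open>insert z G\<close> bounds both by edges of
        \<open>G\<close> alone. Subtracting the strict violation at A, B from the sum of the two
        leaves the surplus 1 that turns S into S - 1.\<close>
      have "sum e (A \<inter> C) + sum f (B \<union> D) \<le> S + int (card (G \<inter> (A \<inter> C) \<times> (B \<union> D)))"
        using insert.prems(6)[of "A \<inter> C" "B \<union> D"] card_ins[of "A \<inter> C" "B \<union> D"] AB CD False by auto
      moreover have "sum e (A \<union> C) + sum f (B \<inter> D) \<le> S + int (card (G \<inter> (A \<union> C) \<times> (B \<inter> D)))"
        using insert.prems(6)[of "A \<union> C" "B \<inter> D"] card_ins[of "A \<union> C" "B \<inter> D"] AB CD False by auto
      moreover have "int (card (G \<inter> (A \<inter> C) \<times> (B \<union> D))) + int (card (G \<inter> (A \<union> C) \<times> (B \<inter> D)))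
          \<le> int (card (G \<inter> A \<times> B)) + int (card (G \<inter> C \<times> D))"
        using card_Times_uncross[OF insert.hyps(1), of A C B D] by linarith
      moreover note sum_Un_Int_swap[of A C e] sum_Un_Int_swap[of B D f]
      ultimately show ?thesis
        using False AB CD fin[OF CD] fin[OF AB(1,2)] by (simp add: e' f')
    qed
    have "\<exists>H \<subseteq> G. (\<forall>x\<in>X. e' x = int (card (H `` {x}))) \<and> (\<forall>y\<in>Y. f' y = int (card (H\<inverse> `` {y})))"
      using insert.prems xy cut by (intro insert.IH[of e' "S - 1" f']) (auto simp: e' f')
    then obtain H where H: "H \<subseteq> G"
      and He: "\<And>u. u \<in> X \<Longrightarrow> e' u = int (card (H `` {u}))"
      and Hf: "\<And>v. v \<in> Y \<Longrightarrow> f' v = int (card (H\<inverse> `` {v}))"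
      by blast
    have "finite H" "z \<notin> H"
      using H insert.hyps by (auto intro: finite_subset)
    have fx: "finite (H `` {u})" for u
      using \<open>finite H\<close> by (rule finite_Image)
    have fy: "finite (H\<inverse> `` {v})" for v
      using \<open>finite H\<close> by (intro finite_Image) simp
    have "insert z H `` {u} = (if u = x then insert y (H `` {u}) else H `` {u})"
      "(insert z H)\<inverse> `` {v} = (if v = y then insert x (H\<inverse> `` {v}) else H\<inverse> `` {v})" for u v
      by (auto simp: z)
    then have "e u = int (card (insert z H `` {u}))" "f v = int (card ((insert z H)\<inverse> `` {v}))"
      if "u \<in> X" "v \<in> Y" for u v
      using He[OF that(1)] Hf[OF that(2)] fx fy \<open>z \<notin> H\<close>
      by (auto simp: z card_insert_if e'_def f'_def split: if_splits)
    moreover have "insert z H \<subseteq> insert z G"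
      using H by blast
    ultimately show ?thesis
      using xy by blast
  qed
qed

section \<open>From graphs with doubleton edges to relations between indices\<close>

lemma bipartite_graph_commute: "bipartite_graph X Y E \<longleftrightarrow> bipartite_graph Y X E"
  unfolding bipartite_graph_def by (metis inf_commute insert_commute)

text \<open>The map from j to the doubleton of \<open>xs ! i\<close> and \<open>ys ! j\<close> is a
  bijection onto the edges at \<open>xs ! i\<close>: disjointness of the parts and distinctness of
  \<open>ys\<close> make it injective. The other part is covered by
  \<open>bipartite_graph_commute\<close>.\<close>

lemma degree_nth:
  assumes "distinct ys" "bipartite_graph (set xs) (set ys) E" "i < length xs"
  shows "degree E (xs ! i) = card {j. j < length ys \<and> {xs ! i, ys ! j} \<in> E}"
proof -
  have disj: "xs ! i \<noteq> ys ! j" if "j < length ys" for j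
    using assms that unfolding bipartite_graph_def by (metis disjoint_iff nth_mem)
  have "\<exists>j < length ys. \<epsilon> = {xs ! i, ys ! j}" if "\<epsilon> \<in> E" "xs ! i \<in> \<epsilon>" for \<epsilon>
  proof -
    have "\<exists>x\<in>set xs. \<exists>y\<in>set ys. \<epsilon> = {x, y}"
      using assms(2) that(1) by (simp add: bipartite_graph_def)
    then obtain x y where xy: "x \<in> set xs" "y \<in> set ys" "\<epsilon> = {x, y}"
      by (elim bexE)
    then obtain j where "j < length ys" "y = ys ! j"
      by (auto simp: in_set_conv_nth)
    then show ?thesis
      using xy that disj by auto
  qed
  then have "{\<epsilon> \<in> E. xs ! i \<in> \<epsilon>} = (\<lambda>j. {xs ! i, ys ! j}) ` {j. j < length ys \<and> {xs ! i, ys ! j} \<in> E}"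
    by auto
  moreover have "inj_on (\<lambda>j. {xs ! i, ys ! j}) {j. j < length ys \<and> {xs ! i, ys ! j} \<in> E}"
    using assms(1) disj by (auto simp: inj_on_def doubleton_eq_iff nth_eq_iff_index_eq)
  ultimately show ?thesis
    by (simp add: degree_def card_image)
qed

text \<open>This removes the choice of vertices: with ordered index pairs in place of doubletons,
  degrees become sizes of rows and columns of \<open>H\<close>.\<close>

lemma bipartite_graphic_iff_relation:
  "bipartite_graphic e f \<longleftrightarrow>
    (\<exists>H \<subseteq> {..<length e} \<times> {..<length f}.
      (\<forall>i<length e. e ! i = int (card (H `` {i}))) \<and> (\<forall>j<length f. f ! j = int (card (H\<inverse> `` {j}))))"
proof
  assume "bipartite_graphic e f"
  then obtain xs ys :: "nat list" and E where *: "distinct xs" "distinct ys" "bipartite_graph (set xs) (set ys) E"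
    and e: "e = map (\<lambda>v. int (degree E v)) xs" and f: "f = map (\<lambda>v. int (degree E v)) ys"
    unfolding bipartite_graphic_def by blast
  define H where "H = {(i, j). i < length e \<and> j < length f \<and> {xs ! i, ys ! j} \<in> E}"
  have "H `` {i} = {j. j < length ys \<and> {xs ! i, ys ! j} \<in> E}" if "i < length e" for i
    using that by (auto simp: H_def f)
  moreover have "H\<inverse> `` {j} = {i. i < length xs \<and> {ys ! j, xs ! i} \<in> E}" if "j < length f" for j
    using that by (auto simp: H_def e insert_commute)
  ultimately have "\<forall>i<length e. e ! i = int (card (H `` {i}))" "\<forall>j<length f. f ! j = int (card (H\<inverse> `` {j}))"
    using degree_nth[OF *(2,3)] degree_nth[OF *(1) bipartite_graph_commute[THEN iffD1, OF *(3)]]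
    by (simp_all add: e f)
  moreover have "H \<subseteq> {..<length e} \<times> {..<length f}"
    by (auto simp: H_def)
  ultimately show "\<exists>H \<subseteq> {..<length e} \<times> {..<length f}.
      (\<forall>i<length e. e ! i = int (card (H `` {i}))) \<and> (\<forall>j<length f. f ! j = int (card (H\<inverse> `` {j})))"
    by blast
next
  assume "\<exists>H \<subseteq> {..<length e} \<times> {..<length f}.
      (\<forall>i<length e. e ! i = int (card (H `` {i}))) \<and> (\<forall>j<length f. f ! j = int (card (H\<inverse> `` {j})))"
  then obtain H where H: "H \<subseteq> {..<length e} \<times> {..<length f}"
    and He: "\<And>i. i < length e \<Longrightarrow> e ! i = int (card (H `` {i}))"
    and Hf: "\<And>j. j < length f \<Longrightarrow> f ! j = int (card (H\<inverse> `` {j}))"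
    by blast
  \<comment> \<open>Two adjacent blocks of natural numbers serve as the disjoint parts.\<close>
  define xs where "xs = [0..<length e]"
  define ys where "ys = [length e..<length e + length f]"
  define E where "E = (\<lambda>(i, j). {xs ! i, ys ! j}) ` H"
  have *: "distinct xs" "distinct ys"
    by (auto simp: xs_def ys_def)
  have bip: "bipartite_graph (set xs) (set ys) E"
    using H unfolding bipartite_graph_def E_def
    by (fastforce simp: xs_def ys_def)
  have E_iff: "{xs ! i, ys ! j} \<in> E \<longleftrightarrow> (i, j) \<in> H" if "i < length e" "j < length f" for i j
  proof
    assume "{xs ! i, ys ! j} \<in> E"
    then obtain i' j' where ij': "(i', j') \<in> H" "{xs ! i, ys ! j} = {xs ! i', ys ! j'}"
      by (auto simp: E_def)
    then have "i' < length e" "j' < length f"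
      using H by auto
    then have "i' = i" "j' = j"
      using ij'(2) that by (auto simp: xs_def ys_def doubleton_eq_iff)
    then show "(i, j) \<in> H"
      using ij' by simp
  qed (auto simp: E_def)
  have "H `` {i} = {j. j < length ys \<and> {xs ! i, ys ! j} \<in> E}" if "i < length e" for i
    using that H E_iff by (auto simp: ys_def)
  moreover have Hcol: "H\<inverse> `` {j} = {i. i < length xs \<and> {ys ! j, xs ! i} \<in> E}" if "j < length f" for j
    using that H E_iff by (auto simp: xs_def insert_commute)
  ultimately have "e ! i = int (degree E (xs ! i))" if "i < length e" for i
    using that He degree_nth[OF *(2) bip, of i] by (simp add: xs_def)
  moreover have "f ! j = int (degree E (ys ! j))" if "j < length f" for j
    using that Hf Hcol degree_nth[OF *(1) bipartite_graph_commute[THEN iffD1, OF bip], of j]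
    by (simp add: ys_def)
  ultimately have "e = map (\<lambda>v. int (degree E v)) xs" "f = map (\<lambda>v. int (degree E v)) ys"
    by (auto intro!: nth_equalityI simp: xs_def ys_def)
  with * bip show "bipartite_graphic e f"
    unfolding bipartite_graphic_def by blast
qed

section \<open>The cut criterion for bipartite graphic pairs\<close>

lemma sum_card_Image:
  assumes "finite H" "finite A"
  shows "(\<Sum>i\<in>A. card (H `` {i})) = card (H \<inter> A \<times> UNIV)"
proof -
  have "H \<inter> A \<times> UNIV = (SIGMA i:A. H `` {i})"
    by auto
  then show ?thesis
    using assms by (simp add: finite_Image)
qed

lemma sum_card_converse_Image:
  assumes "finite H" "finite B"
  shows "(\<Sum>j\<in>B. card (H\<inverse> `` {j})) = card (H \<inter> UNIV \<times> B)"
proof -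
  have "(\<Sum>j\<in>B. card (H\<inverse> `` {j})) = card (H\<inverse> \<inter> B \<times> UNIV)"
    using assms by (intro sum_card_Image) auto
  also have "H\<inverse> \<inter> B \<times> UNIV = (H \<inter> UNIV \<times> B)\<inverse>"
    by auto
  finally show ?thesis
    by simp
qed

text \<open>The Gale--Ryser theorem in min-cut form; unlike the usual formulation it needs no sorting.\<close>

lemma bipartite_graphic_iff_cuts:
  assumes "sum_list e = S" "sum_list f = S"
  shows "bipartite_graphic e f \<longleftrightarrow>
    (\<forall>A \<subseteq> {..<length e}. \<forall>B \<subseteq> {..<length f}.
      sum ((!) e) A + sum ((!) f) B \<le> S + int (card A) * int (card B))"
proof -
  let ?X = "{..<length e}" and ?Y = "{..<length f}"
  have S: "sum ((!) e) ?X = S" "sum ((!) f) ?Y = S"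
    using assms by (simp_all add: sum_list_sum_nth atLeast0LessThan)
  show ?thesis
  proof
    assume "bipartite_graphic e f"
    then obtain H where H: "H \<subseteq> ?X \<times> ?Y"
      and He: "\<And>i. i < length e \<Longrightarrow> e ! i = int (card (H `` {i}))"
      and Hf: "\<And>j. j < length f \<Longrightarrow> f ! j = int (card (H\<inverse> `` {j}))"
      unfolding bipartite_graphic_iff_relation by blast
    have fin: "finite H"
      using H by (rule finite_subset) simp
    have eA: "sum ((!) e) A = int (card (H \<inter> A \<times> UNIV))" if "A \<subseteq> ?X" for A
    proof -
      have "sum ((!) e) A = (\<Sum>i\<in>A. int (card (H `` {i})))"
        using that by (intro sum.cong) (auto simp: He)
      also have "\<dots> = int (\<Sum>i\<in>A. card (H `` {i}))"
        by simp
      also have "\<dots> = int (card (H \<inter> A \<times> UNIV))"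
        using fin that by (subst sum_card_Image) (auto intro: finite_subset)
      finally show ?thesis .
    qed
    have fB: "sum ((!) f) B = int (card (H \<inter> UNIV \<times> B))" if "B \<subseteq> ?Y" for B
    proof -
      have "sum ((!) f) B = (\<Sum>j\<in>B. int (card (H\<inverse> `` {j})))"
        using that by (intro sum.cong) (auto simp: Hf)
      also have "\<dots> = int (\<Sum>j\<in>B. card (H\<inverse> `` {j}))"
        by simp
      also have "\<dots> = int (card (H \<inter> UNIV \<times> B))"
        using fin that by (subst sum_card_converse_Image) (auto intro: finite_subset)
      finally show ?thesis .
    qed
    have cardH: "int (card H) = S"
    proof -
      have "H \<inter> ?X \<times> UNIV = H"
        using H by blast
      then show ?thesis
        using eA[of ?X] S by simp
    qed
    show "\<forall>A \<subseteq> ?X. \<forall>B \<subseteq> ?Y. sum ((!) e) A + sum ((!) f) B \<le> S + int (card A) * int (card B)"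
    proof (intro allI impI)
      fix A B assume AB: "A \<subseteq> ?X" "B \<subseteq> ?Y"
      let ?U = "H \<inter> A \<times> UNIV" and ?V = "H \<inter> UNIV \<times> B"
      \<comment> \<open>Double counting: \<open>?U\<close> and \<open>?V\<close> are the edges
        meeting A and those meeting B. Their union lies in \<open>H\<close>, which has S edges, and
        their intersection lies in \<open>A \<times> B\<close>.\<close>
      have "card ?U + card ?V = card (?U \<union> ?V) + card (?U \<inter> ?V)"
        using fin by (intro card_Un_Int) auto
      also have "\<dots> \<le> card H + card (A \<times> B)"
        using fin AB by (intro add_mono card_mono) (auto intro: finite_subset)
      finally have "card ?U + card ?V \<le> card H + card A * card B"
        by (simp add: card_cartesian_product)
      then have "int (card ?U) + int (card ?V) \<le> int (card H) + int (card A) * int (card B)"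
        by (metis of_nat_add of_nat_mono of_nat_mult)
      then show "sum ((!) e) A + sum ((!) f) B \<le> S + int (card A) * int (card B)"
        using eA[OF AB(1)] fB[OF AB(2)] cardH by simp
    qed
  next
    assume *: "\<forall>A \<subseteq> ?X. \<forall>B \<subseteq> ?Y. sum ((!) e) A + sum ((!) f) B \<le> S + int (card A) * int (card B)"
    \<comment> \<open>The subgraph lemma is applied to the complete bipartite graph, where the edges
      between A and B number |A| |B|.\<close>
    have "\<exists>H \<subseteq> ?X \<times> ?Y. (\<forall>i\<in>?X. e ! i = int (card (H `` {i}))) \<and>
        (\<forall>j\<in>?Y. f ! j = int (card (H\<inverse> `` {j})))"
    proof (rule prescribed_degrees_subgraph[where S = S])
      fix A B assume AB: "A \<subseteq> ?X" "B \<subseteq> ?Y"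
      then have "?X \<times> ?Y \<inter> A \<times> B = A \<times> B"
        by blast
      then show "sum ((!) e) A + sum ((!) f) B \<le> S + int (card (?X \<times> ?Y \<inter> A \<times> B))"
        using * AB by (simp add: card_cartesian_product)
    qed (use S in auto)
    then show "bipartite_graphic e f"
      unfolding bipartite_graphic_iff_relation Ball_def lessThan_iff .
  qed
qed

section \<open>Bounds on partial sums and reduction to corner cuts\<close>

lemma sum_nth_bounds:
  fixes e :: "int list"
  assumes "sum_list e = S" "A \<subseteq> {..<length e}" "Max (set e) = a" "Min (set e) = b"
  shows "sum ((!) e) A \<le> a * int (card A)"
    and "sum ((!) e) A \<le> S - b * (int (length e) - int (card A))"
    and "card A \<le> length e"
proof -
  let ?X = "{..<length e}"
  have between: "b \<le> e ! i \<and> e ! i \<le> a" if "i < length e" for i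
    using that assms(3,4) by auto
  have fin: "finite A"
    using assms(2) by (rule finite_subset) simp
  show c: "card A \<le> length e"
    using card_mono[OF _ assms(2)] by simp
  have "sum ((!) e) A \<le> (\<Sum>i\<in>A. a)"
    using assms(2) between by (intro sum_mono) auto
  then show "sum ((!) e) A \<le> a * int (card A)"
    by (simp add: mult.commute)
  \<comment> \<open>The second bound comes from the complement of A, whose entries are all at least
    b.\<close>
  have "(\<Sum>i\<in>?X - A. b) \<le> sum ((!) e) (?X - A)"
    using between by (intro sum_mono) auto
  also have "\<dots> = S - sum ((!) e) A"
    using assms(1,2) by (subst sum_diff) (auto simp: sum_list_sum_nth atLeast0LessThan)
  finally show "sum ((!) e) A \<le> S - b * (int (length e) - int (card A))"
    using assms(2) fin c by (simp add: card_Diff_subset of_nat_diff algebra_simps)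
qed

lemma linear_le_between:
  fixes k :: int
  assumes "\<alpha> * k0 \<le> \<beta>" "\<alpha> * k1 \<le> \<beta>" "k0 \<le> k" "k \<le> k1"
  shows "\<alpha> * k \<le> \<beta>"
proof (cases "\<alpha> \<ge> 0")
  case True
  then have "\<alpha> * k \<le> \<alpha> * k1"
    using assms by (intro mult_left_mono)
  then show ?thesis
    using assms by simp
next
  case False
  then have "\<alpha> * k \<le> \<alpha> * k0"
    using assms by (intro mult_left_mono_neg) auto
  then show ?thesis
    using assms by simp
qed

text \<open>The difference of the two sides is affine in each variable separately. Interpolating in
  k along the edges l = l0 and l = l1, and then in l for fixed k, reduces it to the corners.\<close>

lemma bilinear_le_on_rectangle:
  fixes k l :: int
  assumes "k0 \<le> k" "k \<le> k1" "l0 \<le> l" "l \<le> l1"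
    and "\<alpha> * k0 + \<beta> * l0 \<le> \<gamma> + k0 * l0" "\<alpha> * k1 + \<beta> * l0 \<le> \<gamma> + k1 * l0"
    and "\<alpha> * k0 + \<beta> * l1 \<le> \<gamma> + k0 * l1" "\<alpha> * k1 + \<beta> * l1 \<le> \<gamma> + k1 * l1"
  shows "\<alpha> * k + \<beta> * l \<le> \<gamma> + k * l"
proof -
  have "(\<alpha> - l0) * k \<le> \<gamma> - \<beta> * l0"
    using assms(5,6) by (intro linear_le_between[OF _ _ assms(1,2)]) (simp_all add: algebra_simps)
  moreover have "(\<alpha> - l1) * k \<le> \<gamma> - \<beta> * l1"
    using assms(7,8) by (intro linear_le_between[OF _ _ assms(1,2)]) (simp_all add: algebra_simps)
  ultimately have "(\<beta> - k) * l \<le> \<gamma> - \<alpha> * k"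
    by (intro linear_le_between[OF _ _ assms(3,4)]) (simp_all add: algebra_simps)
  then show ?thesis
    by (simp add: algebra_simps)
qed

text \<open>E is bounded by a k for k \<le> r and by S - b (m - k) for k \<ge> r + 1, and F
  likewise. Each choice makes the claim bilinear on one of four rectangles, and integrality of k and
  l leaves no gap between the rectangles. The hypotheses \<open>corners\<close> treat the four inner
  corners.\<close>

lemma cut_le_of_corner_cuts:
  fixes a b c d m n r s k l S E F :: int
  assumes "0 \<le> b" "0 \<le> d" "a \<le> n" "c \<le> m" "0 \<le> r" "r < m" "0 \<le> s" "s < n" "0 \<le> S" "S \<le> m * n"
    and r: "a * r \<le> S - b * (m - r)" "S - b * (m - (r + 1)) \<le> a * (r + 1)"
    and s: "c * s \<le> S - d * (n - s)" "S - d * (n - (s + 1)) \<le> c * (s + 1)"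
    and corners: "a * r + c * s \<le> S + r * s"
      "S - b * (m - (r + 1)) + c * s \<le> S + (r + 1) * s"
      "a * r + (S - d * (n - (s + 1))) \<le> S + r * (s + 1)"
      "S - b * (m - (r + 1)) + (S - d * (n - (s + 1))) \<le> S + (r + 1) * (s + 1)"
    and kl: "0 \<le> k" "k \<le> m" "0 \<le> l" "l \<le> n"
    and E: "E \<le> a * k" "E \<le> S - b * (m - k)"
    and F: "F \<le> c * l" "F \<le> S - d * (n - l)"
  shows "E + F \<le> S + k * l"
proof -
  \<comment> \<open>Outer corners: \<open>nonneg\<close> is for those with k = 0 or l = 0,
    \<open>deg\<close> for those with k = m or l = n. At (0, 0) and (m, n) the claim is 0 \<le> S
    and S \<le> m n; at (m, 0) and (0, n) it is an equality.\<close>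
  have nonneg: "0 \<le> b * (m - r)" "0 \<le> b * (m - (r + 1))" "0 \<le> d * (n - s)" "0 \<le> d * (n - (s + 1))"
    using assms by simp_all
  have deg: "a * (r + 1) \<le> n * (r + 1)" "c * (s + 1) \<le> m * (s + 1)" "a * r \<le> n * r" "c * s \<le> m * s"
    using assms by (intro mult_right_mono; simp)+
  consider "k \<le> r" "l \<le> s" | "r + 1 \<le> k" "l \<le> s" | "k \<le> r" "s + 1 \<le> l" | "r + 1 \<le> k" "s + 1 \<le> l"
    by linarith
  then show ?thesis
  proof cases
    case 1
    have "a * k + c * l \<le> S + k * l"
      using nonneg r(1) s(1) corners(1) \<open>0 \<le> S\<close>
      by (intro bilinear_le_on_rectangle[OF kl(1) 1(1) kl(3) 1(2)]) simp_all
    then show ?thesis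
      using E(1) F(1) by linarith
  next
    case 2
    have "b * k + c * l \<le> b * m + k * l"
      using nonneg deg corners(2)
      by (intro bilinear_le_on_rectangle[OF 2(1) kl(2) kl(3) 2(2)]) (simp_all add: algebra_simps)
    then show ?thesis
      using E(2) F(1) by (simp add: algebra_simps)
  next
    case 3
    have "a * k + d * l \<le> d * n + k * l"
      using nonneg deg corners(3)
      by (intro bilinear_le_on_rectangle[OF kl(1) 3(1) 3(2) kl(4)]) (simp_all add: algebra_simps)
    then show ?thesis
      using E(1) F(2) by (simp add: algebra_simps)
  next
    case 4
    have "b * k + d * l \<le> (b * m + d * n - S) + k * l"
      using nonneg deg r(2) s(2) corners(4) \<open>S \<le> m * n\<close>
      by (intro bilinear_le_on_rectangle[OF 4(1) kl(2) 4(2) kl(4)]) (simp_all add: algebra_simps)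
    then show ?thesis
      using E(2) F(2) by (simp add: algebra_simps)
  qed
qed

text \<open>For the cases a = b and, with the sides exchanged, c = d. After replacing E by a k the
  claim is linear in k; it reads F \<le> S at k = 0 and F \<le> m l at k = m.\<close>

lemma cut_le_of_constant_side:
  fixes a m k l S E F :: int
  assumes "E \<le> a * k" "S = a * m" "F \<le> S" "F \<le> m * l" "0 \<le> k" "k \<le> m"
  shows "E + F \<le> S + k * l"
proof -
  have "(a - l) * k \<le> S - F"
    using assms(2-4) by (intro linear_le_between[OF _ _ assms(5,6)]) (simp_all add: algebra_simps)
  then show ?thesis
    using assms(1) by (simp add: algebra_simps)
qed

section \<open>Extremal sequences and the floor quotients r and s\<close>

lemma sum_list_bounds_of_Max_Min:
  fixes e :: "int list"
  assumes "sum_list e = S" "e \<noteq> []" "Max (set e) = a" "Min (set e) = b"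
  shows "a + b * (int (length e) - 1) \<le> S" "S \<le> b + a * (int (length e) - 1)"
proof -
  \<comment> \<open>Since both extreme values are attained, one entry can be split off; this
    sharpens m b \<le> S \<le> m a.\<close>
  obtain i where i: "i < length e" "e ! i = a"
    using Max_in[of "set e"] assms by (auto simp: in_set_conv_nth)
  obtain j where j: "j < length e" "e ! j = b"
    using Min_in[of "set e"] assms by (auto simp: in_set_conv_nth)
  show "a + b * (int (length e) - 1) \<le> S"
    using sum_nth_bounds(2)[OF assms(1) _ assms(3,4), of "{i}"] i by simp
  have "sum ((!) e) ({..<length e} - {j}) = S - b"
    using assms(1) j by (simp add: sum_diff1 sum_list_sum_nth atLeast0LessThan)
  then show "S \<le> b + a * (int (length e) - 1)"
    using sum_nth_bounds(1)[OF assms(1) _ assms(3,4), of "{..<length e} - {j}"] j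
    by (auto simp: of_nat_diff)
qed

text \<open>The sequence below majorizes every other one with the same length, sum, maximum and minimum.\<close>

lemma extremal_sequence:
  fixes a b S :: int
  assumes "0 < r" "r < m" "a * int r \<le> S - b * (int m - int r)"
    "S - b * (int m - (int r + 1)) < a * (int r + 1)" "S \<le> b + a * (int m - 1)"
  obtains e where "length e = m" "sum_list e = S" "e \<noteq> []" "Max (set e) = a" "Min (set e) = b"
    "sum ((!) e) {..<r} = a * int r" "sum ((!) e) {..<Suc r} = S - b * (int m - (int r + 1))"
proof -
  \<comment> \<open>q is what remains after r entries a and m - r entries b. It is less than a - b,
    so a single entry b + q absorbs it.\<close>
  define q where "q = S - a * int r - b * (int m - int r)"
  define e where "e = replicate r a @ (b + q) # replicate (m - r - 1) b"
  have q: "0 \<le> q" "b + q < a"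
    using assms(3,4) by (auto simp: q_def algebra_simps)
  have len: "length e = m"
    using assms(2) by (simp add: e_def)
  have sum_take: "sum ((!) e) {..<k} = sum_list (take k e)" if "k \<le> m" for k
    using that len by (simp add: sum_list_sum_nth atLeast0LessThan)
  have "sum_list e = S"
    using assms(2) by (simp add: e_def q_def sum_list_replicate of_nat_diff algebra_simps)
  moreover have "Max (set e) = a"
    using q assms(1) by (intro Max_eqI) (auto simp: e_def)
  moreover have "b \<in> set e"
  proof (cases "m = Suc r")
    case True
    \<comment> \<open>Here the tail of entries b is empty, so the middle entry itself has to be the
      minimum; the upper bound on S ensures this.\<close>
    then have "q = 0"
      using q assms(5) by (simp add: q_def algebra_simps)
    then show ?thesis
      by (simp add: e_def)
  next
    case False
    then show ?thesis
      using assms(2) by (simp add: e_def)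
  qed
  then have "Min (set e) = b"
    using q by (intro Min_eqI) (auto simp: e_def)
  moreover have "sum ((!) e) {..<r} = a * int r"
    using sum_take[of r] assms(2) by (simp add: e_def sum_list_replicate mult.commute)
  moreover have "sum ((!) e) {..<Suc r} = S - b * (int m - (int r + 1))"
    using sum_take[of "Suc r"] assms(2) by (simp add: e_def q_def sum_list_replicate algebra_simps)
  moreover have "e \<noteq> []"
    by (simp add: e_def)
  ultimately show ?thesis
    using that len by blast
qed

text \<open>With X = S - m b and D = a - b, r is the integer quotient X div D, and the last two
  claims are D r \<le> X < D (r + 1). An attained maximum gives D \<le> X, hence 0 < r; an attained
  minimum gives X \<le> D (m - 1), hence r < m.\<close>

lemma floor_quotient_bounds:
  fixes a b m S :: nat
  assumes "b < a" "int a + int b * (int m - 1) \<le> int S" "int S \<le> int b + int a * (int m - 1)"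
    and r: "r = \<lfloor>(real S - real m * real b) / (real a - real b)\<rfloor>"
  shows "0 < r" "r < int m" "int a * r \<le> int S - int b * (int m - r)"
    "int S - int b * (int m - (r + 1)) < int a * (r + 1)"
proof -
  define X where "X = int S - int m * int b"
  define D where "D = int a - int b"
  have "r = \<lfloor>real_of_int X / real_of_int D\<rfloor>"
    by (simp add: r X_def D_def)
  then have r: "r = X div D"
    by (simp add: floor_divide_of_int_eq)
  have D: "0 < D"
    using assms by (simp add: D_def)
  have "D \<le> X"
    using assms(2) by (simp add: X_def D_def algebra_simps)
  then show "0 < r"
    using D by (simp add: r pos_imp_zdiv_pos_iff)
  have "X = D * r + X mod D" "0 \<le> X mod D" "X mod D < D"
    using D by (simp_all add: r)
  then have X: "D * r \<le> X" "X < D * (r + 1)"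
    by (simp_all add: algebra_simps)
  have "X \<le> D * (int m - 1)"
    using assms(3) by (simp add: X_def D_def algebra_simps)
  then have "D * r \<le> D * (int m - 1)"
    using X by linarith
  then show "r < int m"
    using D by simp
  show "int a * r \<le> int S - int b * (int m - r)"
    "int S - int b * (int m - (r + 1)) < int a * (r + 1)"
    using X by (simp_all add: X_def D_def algebra_simps)
qed

section \<open>The equivalence, by comparison with the extremal pair\<close>

theorem theorem1:
  fixes a b c d m n S :: nat
  assumes "n \<ge> a" and "a \<ge> b" and "m \<ge> c" and "c \<ge> d"
    and "max (m * b) (n * d) \<le> S" and "S \<le> min (m * a) (n * c)"
    and nonempty: "seq_pairs a b c d m n S \<noteq> {}"
  shows "(\<forall>(e, f) \<in> seq_pairs a b c d m n S. bipartite_graphic e f) \<longleftrightarrow>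
    (a = b \<or> c = d \<or>
     (a > b \<and> c > d \<and>
      (let r = \<lfloor>(real S - real m * real b) / (real a - real b)\<rfloor>;
           s = \<lfloor>(real S - real n * real d) / (real c - real d)\<rfloor>;
           p = int S - int c * s - int d * (int n - s);
           q = int S - int a * r - int b * (int m - r)
       in int a * r + int c * s \<le>
            int S + r * s +
            Min {r - p - int d, s - q - int b, r + s - p - q - int b - int d + 1, 0})))"
proof -
  let ?P = "seq_pairs a b c d m n S"
  have P: "length e = m" "length f = n" "sum_list e = int S" "sum_list f = int S" "e \<noteq> []" "f \<noteq> []"
    "Max (set e) = int a" "Min (set e) = int b" "Max (set f) = int c" "Min (set f) = int d"
    if "(e, f) \<in> ?P" for e f
    using that by (auto simp: seq_pairs_def)
  have E: "sum ((!) e) A \<le> int a * int (card A)"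
    "sum ((!) e) A \<le> int S - int b * (int m - int (card A))" "card A \<le> m"
    if "(e, f) \<in> ?P" "A \<subseteq> {..<m}" for e f A
    using sum_nth_bounds[OF P(3)[OF that(1)] _ P(7,8)[OF that(1)], of A] P(1)[OF that(1)] that(2) by simp_all
  have F: "sum ((!) f) B \<le> int c * int (card B)"
    "sum ((!) f) B \<le> int S - int d * (int n - int (card B))" "card B \<le> n"
    if "(e, f) \<in> ?P" "B \<subseteq> {..<n}" for e f B
    using sum_nth_bounds[OF P(4)[OF that(1)] _ P(9,10)[OF that(1)], of B] P(2)[OF that(1)] that(2) by simp_all
  have graphic_iff: "bipartite_graphic e f \<longleftrightarrow>
      (\<forall>A \<subseteq> {..<m}. \<forall>B \<subseteq> {..<n}.
        sum ((!) e) A + sum ((!) f) B \<le> int S + int (card A) * int (card B))"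
    if "(e, f) \<in> ?P" for e f
    using bipartite_graphic_iff_cuts[of e "int S" f] P[OF that] by simp
  have deg: "int c * int l \<le> int m * int l" "int a * int l \<le> int n * int l" for l
    using assms(1,3) by (simp_all add: mult_right_mono)
  have S: "int S \<le> int m * int a" "int m * int b \<le> int S" "int S \<le> int n * int c" "int n * int d \<le> int S"
    using assms(5,6) by (simp_all flip: of_nat_mult)
  consider "a = b" | "c = d" | "b < a" "d < c"
    using assms(2,4) by linarith
  then show ?thesis
  proof cases
    case 1
    have "bipartite_graphic e f" if ef: "(e, f) \<in> ?P" for e f
      unfolding graphic_iff[OF ef]
    proof (intro allI impI)
      fix A B assume AB: "A \<subseteq> {..<m}" "B \<subseteq> {..<n}"
      have "0 \<le> int d * (int n - int (card B))"
        using F(3)[OF ef AB(2)] by simp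
      then have "sum ((!) f) B \<le> int S"
        using F(2)[OF ef AB(2)] by linarith
      then show "sum ((!) e) A + sum ((!) f) B \<le> int S + int (card A) * int (card B)"
        using E(1,3)[OF ef AB(1)] F(1)[OF ef AB(2)] deg(1)[of "card B"] S 1
        by (intro cut_le_of_constant_side[where a = "int a" and m = "int m"])
          (simp_all add: mult.commute)
    qed
    then show ?thesis
      using 1 by blast
  next
    case 2
    have "bipartite_graphic e f" if ef: "(e, f) \<in> ?P" for e f
      unfolding graphic_iff[OF ef]
    proof (intro allI impI)
      fix A B assume AB: "A \<subseteq> {..<m}" "B \<subseteq> {..<n}"
      have "0 \<le> int b * (int m - int (card A))"
        using E(3)[OF ef AB(1)] by simp
      then have "sum ((!) e) A \<le> int S"
        using E(2)[OF ef AB(1)] by linarith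
      then have "sum ((!) f) B + sum ((!) e) A \<le> int S + int (card B) * int (card A)"
        using E(1)[OF ef AB(1)] F(1,3)[OF ef AB(2)] deg(2)[of "card A"] S 2
        by (intro cut_le_of_constant_side[where a = "int c" and m = "int n"])
          (simp_all add: mult.commute)
      then show "sum ((!) e) A + sum ((!) f) B \<le> int S + int (card A) * int (card B)"
        by (simp add: ac_simps)
    qed
    then show ?thesis
      using 2 by blast
  next
    case 3
    define r where "r = \<lfloor>(real S - real m * real b) / (real a - real b)\<rfloor>"
    define s where "s = \<lfloor>(real S - real n * real d) / (real c - real d)\<rfloor>"
    define p where "p = int S - int c * s - int d * (int n - s)"
    define q where "q = int S - int a * r - int b * (int m - r)"
    \<comment> \<open>Any pair will do: it supplies the bounds on S that yield 0 < r < m and 0 < s <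
      n.\<close>
    obtain e0 f0 where ef0: "(e0, f0) \<in> ?P"
      using nonempty by auto
    note e0 = sum_list_bounds_of_Max_Min[OF P(3,5,7,8)[OF ef0], unfolded P(1)[OF ef0]]
    note f0 = sum_list_bounds_of_Max_Min[OF P(4,6,9,10)[OF ef0], unfolded P(2)[OF ef0]]
    note r = floor_quotient_bounds[OF 3(1) e0 r_def]
    note s = floor_quotient_bounds[OF 3(2) f0 s_def]
    \<comment> \<open>The cut inequalities of the extremal pair at (r, s), (r + 1, s), (r, s + 1)
      and (r + 1, s + 1).\<close>
    let ?C1 = "int a * r + int c * s \<le> int S + r * s"
    let ?C2 = "int S - int b * (int m - (r + 1)) + int c * s \<le> int S + (r + 1) * s"
    let ?C3 = "int a * r + (int S - int d * (int n - (s + 1))) \<le> int S + r * (s + 1)"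
    let ?C4 = "int S - int b * (int m - (r + 1)) + (int S - int d * (int n - (s + 1)))
      \<le> int S + (r + 1) * (s + 1)"
    have "int a * r + int c * s \<le> int S + r * s +
        Min {r - p - int d, s - q - int b, r + s - p - q - int b - int d + 1, 0}
      \<longleftrightarrow> ?C1 \<and> ?C2 \<and> ?C3 \<and> ?C4"
    proof -
      have "x \<le> y + Min {w1, w2, w3, 0} \<longleftrightarrow> x \<le> y + w1 \<and> x \<le> y + w2 \<and> x \<le> y + w3 \<and> x \<le> y"
        for x y w1 w2 w3 :: int
        by (auto simp: min_def)
      \<comment> \<open>Since S - b (m - (r + 1)) = a r + q + b, passing from r to r + 1 adds q + b
        on the left and s on the right. Symmetrically, s + 1 adds p + d and r; doing both adds one
        more to the product.\<close>
      moreover have "int a * r + int c * s \<le> int S + r * s + (r - p - int d) \<longleftrightarrow> ?C3"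
        "int a * r + int c * s \<le> int S + r * s + (s - q - int b) \<longleftrightarrow> ?C2"
        "int a * r + int c * s \<le> int S + r * s + (r + s - p - q - int b - int d + 1) \<longleftrightarrow> ?C4"
        by (simp_all add: p_def q_def algebra_simps)
      ultimately show ?thesis
        by blast
    qed
    also have "\<dots> \<longleftrightarrow> (\<forall>(e, f) \<in> ?P. bipartite_graphic e f)"
    proof
      assume C: "?C1 \<and> ?C2 \<and> ?C3 \<and> ?C4"
      have Smn: "int S \<le> int m * int n"
        using S(1) deg(2)[of m] by (simp add: mult.commute)
      have "bipartite_graphic e f" if ef: "(e, f) \<in> ?P" for e f
        unfolding graphic_iff[OF ef]
      proof (intro allI impI)
        fix A B assume AB: "A \<subseteq> {..<m}" "B \<subseteq> {..<n}"
        show "sum ((!) e) A + sum ((!) f) B \<le> int S + int (card A) * int (card B)"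
          by (rule cut_le_of_corner_cuts[where a = "int a" and b = "int b" and c = "int c" and d = "int d"
                and m = "int m" and n = "int n" and r = r and s = s])
            (use C r s Smn assms(1,3) E[OF ef AB(1)] F[OF ef AB(2)] in \<open>(assumption | simp)+\<close>)
      qed
      then show "\<forall>(e, f) \<in> ?P. bipartite_graphic e f"
        by blast
    next
      assume all: "\<forall>(e, f) \<in> ?P. bipartite_graphic e f"
      obtain r' s' where nat: "r = int r'" "s = int s'"
        using r(1) s(1) by (metis less_imp_le nonneg_int_cases)
      \<comment> \<open>The two extremal sequences are built independently. Their initial segments
        of lengths r, r + 1 and s, s + 1 turn the cut condition into the four corner
        inequalities.\<close>
      obtain e where e: "length e = m" "sum_list e = int S" "e \<noteq> []" "Max (set e) = int a"
        "Min (set e) = int b" "sum ((!) e) {..<r'} = int a * r"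
        "sum ((!) e) {..<Suc r'} = int S - int b * (int m - (r + 1))"
        using extremal_sequence[of r' m "int a" "int S" "int b"] r e0 unfolding nat by auto
      obtain f where f: "length f = n" "sum_list f = int S" "f \<noteq> []" "Max (set f) = int c"
        "Min (set f) = int d" "sum ((!) f) {..<s'} = int c * s"
        "sum ((!) f) {..<Suc s'} = int S - int d * (int n - (s + 1))"
        using extremal_sequence[of s' n "int c" "int S" "int d"] s f0 unfolding nat by auto
      have ef: "(e, f) \<in> ?P"
        using e f by (simp add: seq_pairs_def)
      then have "bipartite_graphic e f"
        using all by blast
      then have cut: "sum ((!) e) {..<k} + sum ((!) f) {..<l} \<le> int S + int k * int l"
        if "k \<le> m" "l \<le> n" for k l
        using that unfolding graphic_iff[OF ef]
        by (metis card_lessThan lessThan_subset_iff)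
      have le: "r' \<le> m" "Suc r' \<le> m" "s' \<le> n" "Suc s' \<le> n"
        using r(2) s(2) by (simp_all add: nat)
      show "?C1 \<and> ?C2 \<and> ?C3 \<and> ?C4"
        using cut[OF le(1,3)] cut[OF le(2,3)] cut[OF le(1,4)] cut[OF le(2,4)]
        unfolding e(6,7) f(6,7) by (simp add: nat add.commute)
    qed
    finally have iff: "(\<forall>(e, f) \<in> ?P. bipartite_graphic e f) \<longleftrightarrow>
      int a * r + int c * s \<le> int S + r * s +
        Min {r - p - int d, s - q - int b, r + s - p - q - int b - int d + 1, 0}"
      by (rule sym)
    have strict: "X = (a = b \<or> c = d \<or> (b < a \<and> d < c \<and> Y))" if "X = Y" for X Y
      using that 3 by simp
    show ?thesis
      unfolding Let_def
      by (rule strict[OF iff[unfolded p_def q_def, unfolded r_def s_def]])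
  qed
qed

end
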